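(* Let $0<\lambda\le 1$. Then the class $\mathcal{U}(\lambda)$ is a compact subset of $\mathcal{H}$.
   Context: $\mathbb{D}=\{z\in\mathbb{C}:|z|<1\}$ is the unit disk. $\mathcal{H}$ is the space of analytic functions on $\mathbb{D}$, a locally convex topological vector space with the topology of uniform convergence on compact subsets of $\mathbb{D}$. $\mathcal{A}$ is the class of $f\in\mathcal{H}$ with $f(0)=0$ and $f'(0)=1$. For $0<\lambda\le 1$, $\mathcal{U}(\lambda)$ is the class of functions $f\in\mathcal{A}$ satisfying $$\left|f'(z)\left(\frac{z}{f(z)}\right)^2-1\right|<\lambda\quad\text{for all } z\in\mathbb{D};$$ here functions in $\mathcal{U}(\lambda)$ are non-vanishing in $\mathbb{D}\setminus\{0\}$, and $z/f(z)$ is understood to take the value $1$ at $z=0$. *)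

theory Defs
  imports "HOL-Complex_Analysis.Complex_Analysis"
begin

abbreviation unit_disk :: "complex set"  (\<open>\<bbbD>\<close>)
  where "\<bbbD> \<equiv> ball 0 1"

text \<open>
  Functions on the disk are total functions that are \<^const>\<open>undefined\<close> off the disk, so that
  equality in \<open>\<H>\<close> is equality on the disk.
\<close>
definition analytic_disk :: "(complex \<Rightarrow> complex) set"  (\<open>\<H>\<close>)
  where "\<H> = {f \<in> extensional \<bbbD>. f analytic_on \<bbbD>}"

text \<open>
  The topology of uniform convergence on compact subsets: the sets
  \<open>{g \<in> \<H>. \<forall>z\<in>K. dist (f z) (g z) < e}\<close>, for compact \<open>K \<subseteq> \<bbbD>\<close> and \<open>e > 0\<close>,
  form a neighbourhood base at \<open>f\<close> (they are open by \<open>openin_H_topology_basic\<close> below).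
\<close>
definition H_open :: "(complex \<Rightarrow> complex) set \<Rightarrow> bool" where
  "H_open V \<longleftrightarrow> V \<subseteq> \<H> \<and>
     (\<forall>f\<in>V. \<exists>K e. compact K \<and> K \<subseteq> \<bbbD> \<and> e > 0 \<and>
        {g \<in> \<H>. \<forall>z\<in>K. dist (f z) (g z) < e} \<subseteq> V)"

definition H_topology :: "(complex \<Rightarrow> complex) topology"
  where "H_topology = topology H_open"

lemma istopology_H_open: "istopology H_open"
  unfolding istopology_def
proof (intro conjI allI impI)
  fix S T assume S: "H_open S" and T: "H_open T"
  show "H_open (S \<inter> T)"
    unfolding H_open_def
  proof (intro conjI ballI)
    show "S \<inter> T \<subseteq> \<H>" using S by (auto simp: H_open_def)
  next
    fix f assume f: "f \<in> S \<inter> T"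
    obtain K d where K: "compact K" "K \<subseteq> \<bbbD>" "d > 0"
        "{g \<in> \<H>. \<forall>z\<in>K. dist (f z) (g z) < d} \<subseteq> S"
      using S f unfolding H_open_def by (meson IntD1)
    obtain L e where L: "compact L" "L \<subseteq> \<bbbD>" "e > 0"
        "{g \<in> \<H>. \<forall>z\<in>L. dist (f z) (g z) < e} \<subseteq> T"
      using T f unfolding H_open_def by (meson IntD2)
    have "{g \<in> \<H>. \<forall>z\<in>K \<union> L. dist (f z) (g z) < min d e} \<subseteq> S \<inter> T"
      using K(4) L(4) by auto
    moreover have "compact (K \<union> L)" "K \<union> L \<subseteq> \<bbbD>" "min d e > 0"
      using K L by auto
    ultimately show "\<exists>K e. compact K \<and> K \<subseteq> \<bbbD> \<and> e > 0 \<and>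
        {g \<in> \<H>. \<forall>z\<in>K. dist (f z) (g z) < e} \<subseteq> S \<inter> T"
      by blast
  qed
next
  fix \<V> assume V: "\<forall>V\<in>\<V>. H_open V"
  show "H_open (\<Union>\<V>)"
    unfolding H_open_def
  proof (intro conjI ballI)
    show "\<Union>\<V> \<subseteq> \<H>" using V by (auto simp: H_open_def)
  next
    fix f assume "f \<in> \<Union>\<V>"
    then obtain V where "V \<in> \<V>" "f \<in> V" by blast
    then obtain K e where "compact K" "K \<subseteq> \<bbbD>" "e > 0"
        "{g \<in> \<H>. \<forall>z\<in>K. dist (f z) (g z) < e} \<subseteq> V"
      using V unfolding H_open_def by meson
    then show "\<exists>K e. compact K \<and> K \<subseteq> \<bbbD> \<and> e > 0 \<and>
        {g \<in> \<H>. \<forall>z\<in>K. dist (f z) (g z) < e} \<subseteq> \<Union>\<V>"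
      using \<open>V \<in> \<V>\<close> by blast
  qed
qed

lemma openin_H_topology: "openin H_topology V \<longleftrightarrow> H_open V"
  by (simp add: H_topology_def istopology_H_open)

lemma topspace_H_topology [simp]: "topspace H_topology = \<H>"
proof
  show "topspace H_topology \<subseteq> \<H>"
    by (auto simp: topspace_def openin_H_topology H_open_def)
  have "H_open \<H>"
    unfolding H_open_def by (auto intro!: exI[of _ "{}"] exI[of _ "1::real"])
  then show "\<H> \<subseteq> topspace H_topology"
    by (simp add: openin_H_topology openin_subset)
qed

lemma openin_H_topology_basic:
  assumes f: "f \<in> \<H>" and K: "compact K" "K \<subseteq> \<bbbD>"
  shows "openin H_topology {g \<in> \<H>. \<forall>z\<in>K. dist (f z) (g z) < e}"
  unfolding openin_H_topology H_open_def
proof (intro conjI ballI)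
  fix g assume "g \<in> {g \<in> \<H>. \<forall>z\<in>K. dist (f z) (g z) < e}"
  then have g: "g \<in> \<H>" and fg: "\<And>z. z \<in> K \<Longrightarrow> dist (f z) (g z) < e" by auto
  have cont: "continuous_on K h" if "h \<in> \<H>" for h
    using that K(2) unfolding analytic_disk_def
    by (blast intro: continuous_on_subset holomorphic_on_imp_continuous_on analytic_imp_holomorphic)
  obtain d where d: "d > 0" "\<And>z. z \<in> K \<Longrightarrow> dist (f z) (g z) \<le> e - d"
  proof (cases "K = {}")
    case True
    then show ?thesis using that[of 1] by simp
  next
    case False
    have "continuous_on K (\<lambda>z. dist (f z) (g z))"
      using cont[OF f] cont[OF g] by (rule continuous_on_dist)
    from continuous_attains_sup[OF K(1) False this] obtain w
      where "w \<in> K" "\<And>z. z \<in> K \<Longrightarrow> dist (f z) (g z) \<le> dist (f w) (g w)" by blast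
    then show ?thesis using that[of "e - dist (f w) (g w)"] fg[of w] by simp
  qed
  have "dist (f z) (h z) < e" if "z \<in> K" "dist (g z) (h z) < d" for z h
    using d(2)[OF that(1)] that(2) dist_triangle[of "f z" "h z" "g z"] by linarith
  then have "{h \<in> \<H>. \<forall>z\<in>K. dist (g z) (h z) < d} \<subseteq> {g \<in> \<H>. \<forall>z\<in>K. dist (f z) (g z) < e}"
    by blast
  then show "\<exists>L d. compact L \<and> L \<subseteq> \<bbbD> \<and> d > 0 \<and>
      {h \<in> \<H>. \<forall>z\<in>L. dist (g z) (h z) < d} \<subseteq> {g \<in> \<H>. \<forall>z\<in>K. dist (f z) (g z) < e}"
    using K d(1) by blast
qed blast

definition class_A :: "(complex \<Rightarrow> complex) set"  (\<open>\<A>\<close>)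
  where "\<A> = {f \<in> \<H>. f 0 = 0 \<and> deriv f 0 = 1}"

text \<open>\<open>z / f z\<close> with its removable singularity at \<open>0\<close> filled in, for \<open>f \<in> \<A>\<close>.\<close>
definition z_over :: "(complex \<Rightarrow> complex) \<Rightarrow> complex \<Rightarrow> complex"
  where "z_over f z = (if z = 0 then 1 else z / f z)"

definition class_U :: "real \<Rightarrow> (complex \<Rightarrow> complex) set"  (\<open>\<U>\<close>)
  where "\<U> r = {f \<in> \<A>. (\<forall>z\<in>\<bbbD> - {0}. f z \<noteq> 0) \<and>
    (\<forall>z\<in>\<bbbD>. norm (deriv f z * (z_over f z)\<^sup>2 - 1) < r)}"

end

theory Submission
  imports Defs
begin

text \<open>
  The class is easier to control through \<open>g = z / f\<close> than through \<open>f\<close> itself. For such a quotient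
  \<open>f' (z / f)\<^sup>2 = g - z g'\<close>, so \<open>f\<close> lies in \<open>\<U> r\<close> exactly when \<open>g\<close> is holomorphic and zero-free on the
  disk, \<open>g 0 = 1\<close>, and \<open>\<bar>g - z g' - 1\<bar> < r\<close> (\<open>z_over_in_denominators\<close>,
  \<open>restrict_quotient_in_class_U\<close>): a condition that is affine in \<open>g\<close>, up to zero-freeness.

  These denominators are uniformly bounded (\<open>denominators_bounded\<close>). Writing \<open>g = 1 + z k\<close>, the
  inequality becomes \<open>\<bar>z\<^sup>2 k'\<bar> < r\<close>, hence \<open>\<bar>k'\<bar> \<le> r \<le> 1\<close> by the maximum principle, and \<open>k\<close> stays within
  distance \<open>1\<close> of \<open>k 0\<close>. If \<open>k 0\<close> were large, then \<open>z \<mapsto> - 1 / k z\<close> would have a fixed point, which is a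
  zero of \<open>g\<close>; so zero-freeness bounds \<open>k 0\<close>.

  Montel's theorem now extracts from any sequence of denominators a locally uniformly convergent
  subsequence. Its limit \<open>G\<close> is again a denominator (\<open>denominators_limit\<close>): since \<open>G 0 = 1\<close>, Hurwitz's
  theorem keeps it zero-free, and the strict inequality, which might degenerate to \<open>\<le>\<close> in the limit,
  is restored by the maximum principle because \<open>G - z G' - 1\<close> vanishes at \<open>0\<close>. Dividing, the functions
  \<open>f = z / g\<close> converge locally uniformly to \<open>z / G\<close>.

  Thus every sequence in \<open>\<U> r\<close> has a subsequence converging in \<open>\<H>\<close> to an element of \<open>\<U> r\<close>. The
  passage to covering compactness (\<open>compactin_H_topology_if_convergent_subseq\<close>) rests on the
  topology having a countable system of uniform balls, coming from an exhaustion of the disk.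
\<close>

section \<open>Compactness from convergent subsequences\<close>

definition exhausting_disk :: "nat \<Rightarrow> complex set"
  where "exhausting_disk n = cball 0 (1 - 1 / (real n + 2))"

text \<open>
  One index serves both for the disk and for the radius, so that these balls form a countable,
  decreasing neighbourhood base at \<open>f\<close>. They play the part of the balls of radius \<open>1 / (n + 1)\<close> of a
  metric on \<open>\<H>\<close>, with \<open>H_ball_triangle\<close> in place of the triangle inequality.
\<close>
definition H_ball :: "nat \<Rightarrow> (complex \<Rightarrow> complex) \<Rightarrow> (complex \<Rightarrow> complex) set"
  where "H_ball n f = {g \<in> \<H>. \<forall>z\<in>exhausting_disk n. dist (f z) (g z) < 1 / (real n + 1)}"

lemma compact_exhausting_disk: "compact (exhausting_disk n)"
  by (simp add: exhausting_disk_def)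

lemma exhausting_disk_subset: "exhausting_disk n \<subseteq> \<bbbD>"
  by (simp add: exhausting_disk_def cball_subset_ball_iff)

lemma exhausting_disk_mono: "m \<le> n \<Longrightarrow> exhausting_disk m \<subseteq> exhausting_disk n"
  unfolding exhausting_disk_def by (intro subset_cball diff_left_mono divide_left_mono) auto

lemma compact_subset_exhausting_disk:
  assumes "compact K" "K \<subseteq> \<bbbD>"
  obtains N where "\<And>n. n \<ge> N \<Longrightarrow> K \<subseteq> exhausting_disk n"
proof -
  obtain s where s: "s < 1" "K \<subseteq> cball 0 s"
  proof (cases "K = {}")
    case True
    then show ?thesis using that[of 0] by simp
  next
    case False
    have "continuous_on K (\<lambda>z. norm z)" by (intro continuous_intros)
    from continuous_attains_sup[OF assms(1) False this] obtain w
      where w: "w \<in> K" "\<And>z. z \<in> K \<Longrightarrow> norm z \<le> norm w" by blast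
    show ?thesis
    proof (rule that)
      show "norm w < 1" using w(1) assms(2) by auto
      show "K \<subseteq> cball 0 (norm w)" using w(2) by auto
    qed
  qed
  obtain N :: nat where N: "inverse (of_nat (Suc N)) < 1 - s"
    using reals_Archimedean[of "1 - s"] s(1) by auto
  have "K \<subseteq> exhausting_disk N"
  proof -
    have "1 / (real N + 2) \<le> inverse (of_nat (Suc N))" by (simp add: field_simps)
    then have "s \<le> 1 - 1 / (real N + 2)" using N by linarith
    then show ?thesis using s(2) unfolding exhausting_disk_def by (meson order_trans subset_cball)
  qed
  then show ?thesis using that[of N] exhausting_disk_mono by blast
qed

lemma H_ball_mono:
  assumes "m \<le> n"
  shows "H_ball n f \<subseteq> H_ball m f"
proof -
  have "1 / (real n + 1) \<le> 1 / (real m + 1)" using assms by (intro divide_left_mono) auto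
  then show ?thesis using exhausting_disk_mono[OF assms] unfolding H_ball_def by force
qed

lemma H_ball_sym: "f \<in> \<H> \<Longrightarrow> g \<in> H_ball n f \<Longrightarrow> f \<in> H_ball n g"
  by (simp add: H_ball_def dist_commute)

text \<open>The index \<open>2 * n + 1\<close> is the one whose radius \<open>1 / (2 * n + 2)\<close> is half of \<open>1 / (n + 1)\<close>.\<close>
lemma H_ball_triangle:
  assumes "g \<in> H_ball (2 * n + 1) f" "h \<in> H_ball (2 * n + 1) g"
  shows "h \<in> H_ball n f"
proof -
  have "dist (f z) (h z) < 1 / (real n + 1)" if "z \<in> exhausting_disk n" for z
  proof -
    have z: "z \<in> exhausting_disk (2 * n + 1)" using that exhausting_disk_mono[of n "2 * n + 1"] by auto
    have "dist (f z) (g z) < 1 / (2 * real n + 2)" "dist (g z) (h z) < 1 / (2 * real n + 2)"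
      using assms z by (auto simp: H_ball_def add.commute)
    moreover have "1 / (2 * real n + 2) + 1 / (2 * real n + 2) = 1 / (real n + 1)"
      by (simp add: divide_simps)
    ultimately show ?thesis using dist_triangle[of "f z" "h z" "g z"] by linarith
  qed
  then show ?thesis using assms by (simp add: H_ball_def)
qed

lemma H_open_contains_H_ball:
  assumes "openin H_topology V" "f \<in> V"
  obtains n where "H_ball n f \<subseteq> V"
proof -
  obtain K e where K: "compact K" "K \<subseteq> \<bbbD>" "e > 0" "{g \<in> \<H>. \<forall>z\<in>K. dist (f z) (g z) < e} \<subseteq> V"
    using assms unfolding openin_H_topology H_open_def by meson
  obtain N where N: "\<And>n. n \<ge> N \<Longrightarrow> K \<subseteq> exhausting_disk n"
    using compact_subset_exhausting_disk[OF K(1,2)] by blast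
  obtain M :: nat where M: "inverse (of_nat (Suc M)) < e"
    using reals_Archimedean K(3) by blast
  define n where "n = max N M"
  have "1 / (real n + 1) \<le> 1 / (real M + 1)" unfolding n_def by (intro divide_left_mono) auto
  also have "\<dots> < e" using M by (simp add: field_simps)
  finally have "H_ball n f \<subseteq> {g \<in> \<H>. \<forall>z\<in>K. dist (f z) (g z) < e}"
    using N[of n] unfolding H_ball_def n_def by force
  then show ?thesis using K(4) that by blast
qed

lemma uniform_limit_eventually_H_ball:
  assumes lim: "\<And>K. compact K \<Longrightarrow> K \<subseteq> \<bbbD> \<Longrightarrow> uniform_limit K \<sigma> f sequentially"
    and \<sigma>: "\<And>j. \<sigma> j \<in> \<H>"
  shows "\<forall>\<^sub>F j in sequentially. \<sigma> j \<in> H_ball n f"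
proof -
  have "uniform_limit (exhausting_disk n) \<sigma> f sequentially"
    by (intro lim compact_exhausting_disk exhausting_disk_subset)
  then have "\<forall>\<^sub>F j in sequentially. \<forall>z\<in>exhausting_disk n. dist (\<sigma> j z) (f z) < 1 / (real n + 1)"
    by (rule uniform_limitD) simp
  then show ?thesis
    by eventually_elim (simp add: H_ball_def \<sigma> dist_commute)
qed

text \<open>
  The argument is the one for metric spaces. Convergent subsequences give total boundedness at
  every scale \<open>n\<close>, since a sequence of points pairwise separated at scale \<open>n\<close> has no convergent
  subsequence. They also give a Lebesgue number \<open>n\<close> for an open cover: all balls of index \<open>n\<close> with
  centre in \<open>S\<close> fit into a member of the cover. Finitely many such balls cover \<open>S\<close>.
\<close>
lemma compactin_H_topology_if_convergent_subseq:
  assumes SH: "S \<subseteq> \<H>"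
    and subseq: "\<And>\<sigma>::nat \<Rightarrow> complex \<Rightarrow> complex. range \<sigma> \<subseteq> S \<Longrightarrow>
      \<exists>f\<in>S. \<exists>s. strict_mono s \<and>
        (\<forall>K. compact K \<longrightarrow> K \<subseteq> \<bbbD> \<longrightarrow> uniform_limit K (\<sigma> \<circ> s) f sequentially)"
  shows "compactin H_topology S"
proof -
  have limit: "\<exists>f\<in>S. \<exists>s. strict_mono s \<and> (\<forall>n. \<forall>\<^sub>F j in sequentially. \<sigma> (s j) \<in> H_ball n f)"
    if \<sigma>: "\<And>j. \<sigma> j \<in> S" for \<sigma> :: "nat \<Rightarrow> complex \<Rightarrow> complex"
  proof -
    have "range \<sigma> \<subseteq> S" using \<sigma> by blast
    from subseq[OF this] obtain f s where fs: "f \<in> S" "strict_mono s"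
      "\<And>K. compact K \<Longrightarrow> K \<subseteq> \<bbbD> \<Longrightarrow> uniform_limit K (\<sigma> \<circ> s) f sequentially" by blast
    have "\<forall>\<^sub>F j in sequentially. (\<sigma> \<circ> s) j \<in> H_ball n f" for n
      using fs(3) by (rule uniform_limit_eventually_H_ball) (use \<sigma> SH in auto)
    then show ?thesis using fs(1,2) by auto
  qed

  have totally_bounded: "\<exists>T. finite T \<and> T \<subseteq> S \<and> S \<subseteq> (\<Union>f\<in>T. H_ball n f)" for n
  proof (rule ccontr)
    assume no: "\<not> ?thesis"
    have "\<exists>\<sigma>. \<forall>j::nat. \<sigma> j \<in> S \<and> (\<forall>i<j. \<sigma> j \<notin> H_ball n (\<sigma> i))"
    proof (rule dependent_wellorder_choice)
      fix j :: nat and \<sigma>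
      assume "\<And>i. i < j \<Longrightarrow> \<sigma> i \<in> S \<and> (\<forall>i'<i. \<sigma> i \<notin> H_ball n (\<sigma> i'))"
      then have "finite (\<sigma> ` {..<j})" "\<sigma> ` {..<j} \<subseteq> S" by auto
      then have "\<not> S \<subseteq> (\<Union>f\<in>\<sigma> ` {..<j}. H_ball n f)" using no by blast
      then show "\<exists>g. g \<in> S \<and> (\<forall>i<j. g \<notin> H_ball n (\<sigma> i))" by auto
    qed auto
    then obtain \<sigma> where \<sigma>: "\<And>j. \<sigma> j \<in> S" "\<And>i j::nat. i < j \<Longrightarrow> \<sigma> j \<notin> H_ball n (\<sigma> i)" by blast
    from limit[of \<sigma>, OF \<sigma>(1)] obtain f s where fs: "f \<in> S" "strict_mono s"
      "\<And>m. \<forall>\<^sub>F j in sequentially. \<sigma> (s j) \<in> H_ball m f" by blast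
    obtain N where N: "\<And>j. j \<ge> N \<Longrightarrow> \<sigma> (s j) \<in> H_ball (2 * n + 1) f"
      using fs(3)[of "2 * n + 1"] unfolding eventually_sequentially by blast
    have "f \<in> H_ball (2 * n + 1) (\<sigma> (s N))"
    proof (rule H_ball_sym)
      show "f \<in> \<H>" using fs(1) SH by blast
      show "\<sigma> (s N) \<in> H_ball (2 * n + 1) f" by (rule N) simp
    qed
    then have "\<sigma> (s (Suc N)) \<in> H_ball n (\<sigma> (s N))"
      by (rule H_ball_triangle) (rule N, simp)
    moreover have "s N < s (Suc N)" using fs(2) by (simp add: strict_mono_Suc_iff)
    ultimately show False using \<sigma>(2) by blast
  qed

  show ?thesis
    unfolding compactin_def
  proof (intro conjI allI impI)
    show "S \<subseteq> topspace H_topology" using SH by simp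
  next
    fix \<V> assume "(\<forall>V\<in>\<V>. openin H_topology V) \<and> S \<subseteq> \<Union>\<V>"
    then have op: "\<And>V. V \<in> \<V> \<Longrightarrow> openin H_topology V" and cover: "S \<subseteq> \<Union>\<V>" by auto
    have "\<exists>n. \<forall>f\<in>S. \<exists>V\<in>\<V>. H_ball n f \<subseteq> V"
    proof (rule ccontr)
      assume "\<not> ?thesis"
      then have "\<forall>n. \<exists>f. f \<in> S \<and> (\<forall>V\<in>\<V>. \<not> H_ball n f \<subseteq> V)" by blast
      then obtain \<sigma> where \<sigma>: "\<And>n. \<sigma> n \<in> S" "\<And>n V. V \<in> \<V> \<Longrightarrow> \<not> H_ball n (\<sigma> n) \<subseteq> V"
        using choice[of "\<lambda>n f. f \<in> S \<and> (\<forall>V\<in>\<V>. \<not> H_ball n f \<subseteq> V)"] by blast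
      from limit[of \<sigma>, OF \<sigma>(1)] obtain f s where fs: "f \<in> S" "strict_mono s"
        "\<And>m. \<forall>\<^sub>F j in sequentially. \<sigma> (s j) \<in> H_ball m f" by blast
      obtain V where V: "V \<in> \<V>" "f \<in> V" using cover fs(1) by blast
      obtain n where n: "H_ball n f \<subseteq> V" using H_open_contains_H_ball[OF op[OF V(1)] V(2)] .
      obtain N where N: "\<And>j. j \<ge> N \<Longrightarrow> \<sigma> (s j) \<in> H_ball (2 * n + 1) f"
        using fs(3)[of "2 * n + 1"] unfolding eventually_sequentially by blast
      define j where "j = max N (2 * n + 1)"
      \<comment> \<open>\<open>j\<close> is large enough that the ball around \<open>\<sigma> (s j)\<close>, whose index is \<open>s j \<ge> j\<close>, is small too.\<close>
      have "2 * n + 1 \<le> s j"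
        using seq_suble[OF fs(2), of j] unfolding j_def by linarith
      then have "H_ball (s j) (\<sigma> (s j)) \<subseteq> H_ball (2 * n + 1) (\<sigma> (s j))" by (rule H_ball_mono)
      also have "\<dots> \<subseteq> H_ball n f"
      proof
        fix h assume h: "h \<in> H_ball (2 * n + 1) (\<sigma> (s j))"
        have "\<sigma> (s j) \<in> H_ball (2 * n + 1) f" by (rule N) (simp add: j_def)
        then show "h \<in> H_ball n f" using h by (rule H_ball_triangle)
      qed
      finally show False using \<sigma>(2)[OF V(1)] n by blast
    qed
    then obtain n where "\<forall>f\<in>S. \<exists>V\<in>\<V>. H_ball n f \<subseteq> V" ..
    then obtain W where W: "\<And>f. f \<in> S \<Longrightarrow> W f \<in> \<V>" "\<And>f. f \<in> S \<Longrightarrow> H_ball n f \<subseteq> W f"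
      using bchoice[of S "\<lambda>f V. V \<in> \<V> \<and> H_ball n f \<subseteq> V"] by blast
    from totally_bounded[of n] obtain T
      where T: "finite T" "T \<subseteq> S" "S \<subseteq> (\<Union>f\<in>T. H_ball n f)" by (elim exE conjE)
    have "(\<Union>f\<in>T. H_ball n f) \<subseteq> (\<Union>f\<in>T. W f)"
      by (rule UN_mono[OF order_refl]) (use W(2) T(2) in blast)
    with T(3) have "S \<subseteq> \<Union>(W ` T)" by (rule order_trans)
    moreover have "finite (W ` T)" "W ` T \<subseteq> \<V>" using T(1,2) W(1) by auto
    ultimately show "\<exists>\<F>. finite \<F> \<and> \<F> \<subseteq> \<V> \<and> S \<subseteq> \<Union>\<F>" by blast
  qed
qed


section \<open>The denominators \<open>z / f z\<close>\<close>

definition denominators :: "real \<Rightarrow> (complex \<Rightarrow> complex) set" where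
  "denominators r = {g. g holomorphic_on \<bbbD> \<and> g 0 = 1 \<and>
     (\<forall>z\<in>\<bbbD>. g z \<noteq> 0 \<and> norm (g z - z * deriv g z - 1) < r)}"

text \<open>
  This is the quotient rule. The identity turns the quadratic condition that defines \<open>\<U> r\<close> into
  one that is affine in \<open>g\<close>, which is what makes both the bound and the limit tractable.
\<close>
lemma deriv_z_over_denominator:
  assumes holg: "g holomorphic_on \<bbbD>" and g0: "g 0 = 1" and nz: "\<And>z. z \<in> \<bbbD> \<Longrightarrow> g z \<noteq> 0"
    and f: "\<And>z. z \<in> \<bbbD> \<Longrightarrow> f z = z / g z" and z: "z \<in> \<bbbD>"
  shows "deriv f z * (z_over f z)\<^sup>2 = g z - z * deriv g z"
proof -
  have dg: "(g has_field_derivative deriv g z) (at z)"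
    using holg z by (intro holomorphic_derivI) auto
  have "((\<lambda>z. z / g z) has_field_derivative (1 * g z - z * deriv g z) / (g z * g z)) (at z)"
    using nz[OF z] dg by (intro DERIV_divide DERIV_ident) auto
  then have "(f has_field_derivative (1 * g z - z * deriv g z) / (g z * g z)) (at z)"
    by (rule has_field_derivative_transform_within_open[of _ _ _ \<bbbD>]) (use f z in auto)
  then have "deriv f z = (g z - z * deriv g z) / (g z)\<^sup>2"
    by (simp add: DERIV_imp_deriv power2_eq_square)
  moreover have "z_over f z = g z"
    using f[OF z] nz[OF z] g0 by (auto simp: z_over_def)
  ultimately show "deriv f z * (z_over f z)\<^sup>2 = g z - z * deriv g z"
    using nz[OF z] by simp
qed

text \<open>
  The function \<open>f z / z\<close> extends holomorphically to \<open>0\<close> with value \<open>f' 0 = 1\<close> and has no zeros; the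
  denominator is its reciprocal.
\<close>
lemma z_over_in_denominators:
  assumes "f \<in> \<U> r"
  shows "z_over f \<in> denominators r" and "f = restrict (\<lambda>z. z / z_over f z) \<bbbD>"
proof -
  have ext: "f \<in> extensional \<bbbD>" and holf: "f holomorphic_on \<bbbD>"
    and f0: "f 0 = 0" and df: "deriv f 0 = 1"
    and nz: "\<And>z. z \<in> \<bbbD> \<Longrightarrow> z \<noteq> 0 \<Longrightarrow> f z \<noteq> 0"
    and bd: "\<And>z. z \<in> \<bbbD> \<Longrightarrow> norm (deriv f z * (z_over f z)\<^sup>2 - 1) < r"
    using assms
    by (auto simp: class_U_def class_A_def analytic_disk_def analytic_imp_holomorphic)
  have "(\<lambda>z. if z = 0 then deriv f 0 else (f z - f 0) / (z - 0)) holomorphic_on \<bbbD>"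
    by (rule pole_lemma_open[OF holf open_ball])
  then have "(\<lambda>z. inverse (if z = 0 then deriv f 0 else (f z - f 0) / (z - 0))) holomorphic_on \<bbbD>"
    by (rule holomorphic_on_inverse) (use nz df f0 in \<open>auto simp: divide_simps\<close>)
  moreover have "inverse (if z = 0 then deriv f 0 else (f z - f 0) / (z - 0)) = z_over f z" for z
    by (auto simp: z_over_def f0 df)
  ultimately have hol: "z_over f holomorphic_on \<bbbD>" by simp
  have z0: "z_over f 0 = 1" by (simp add: z_over_def)
  have znz: "z_over f z \<noteq> 0" if "z \<in> \<bbbD>" for z using nz[OF that] by (simp add: z_over_def)
  have feq: "f z = z / z_over f z" if "z \<in> \<bbbD>" for z
    using nz[OF that] f0 by (auto simp: z_over_def)
  have "norm (z_over f z - z * deriv (z_over f) z - 1) < r" if z: "z \<in> \<bbbD>" for z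
    using deriv_z_over_denominator[OF hol z0 znz feq z] bd[OF z] by simp
  then show "z_over f \<in> denominators r"
    using hol z0 znz by (simp add: denominators_def)
  show "f = restrict (\<lambda>z. z / z_over f z) \<bbbD>"
    using feq ext by (auto simp: restrict_def extensional_def fun_eq_iff)
qed

lemma restrict_quotient_in_class_U:
  assumes "g \<in> denominators r"
  shows "restrict (\<lambda>z. z / g z) \<bbbD> \<in> \<U> r"
proof -
  define f where "f = restrict (\<lambda>z. z / g z) \<bbbD>"
  have hol: "g holomorphic_on \<bbbD>" and g0: "g 0 = 1"
    and nz: "\<And>z. z \<in> \<bbbD> \<Longrightarrow> g z \<noteq> 0"
    and bd: "\<And>z. z \<in> \<bbbD> \<Longrightarrow> norm (g z - z * deriv g z - 1) < r"
    using assms by (auto simp: denominators_def)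
  have f: "f z = z / g z" if "z \<in> \<bbbD>" for z using that by (simp add: f_def)
  note quotient = deriv_z_over_denominator[OF hol g0 nz f]
  have "(\<lambda>z. z / g z) holomorphic_on \<bbbD>" using hol nz by (intro holomorphic_intros) auto
  then have "f holomorphic_on \<bbbD>" by (rule holomorphic_transform) (use f in simp)
  moreover have "f \<in> extensional \<bbbD>" by (simp add: f_def)
  ultimately have "f \<in> \<H>" by (simp add: analytic_disk_def analytic_on_open)
  moreover have "f 0 = 0" using f[of 0] by simp
  moreover have "deriv f 0 = 1" using quotient[of 0] g0 by (simp add: z_over_def)
  moreover have "f z \<noteq> 0" if "z \<in> \<bbbD> - {0}" for z using that f[of z] nz[of z] by simp
  moreover have "norm (deriv f z * (z_over f z)\<^sup>2 - 1) < r" if "z \<in> \<bbbD>" for z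
    using bd[OF that] quotient[OF _ _ that] by simp
  ultimately show ?thesis by (simp add: class_U_def class_A_def flip: f_def)
qed


section \<open>A uniform bound for the denominators\<close>

text \<open>
  A form of the Schwarz lemma: on the circle of radius \<open>t\<close> the hypothesis reads \<open>\<bar>h\<bar> \<le> B / t ^ m\<close>, the
  maximum principle carries this bound inside, and \<open>t\<close> tends to \<open>1\<close>.
\<close>
lemma norm_le_of_power_mult:
  fixes h :: "complex \<Rightarrow> complex"
  assumes hol: "h holomorphic_on \<bbbD>" and le: "\<And>z. z \<in> \<bbbD> \<Longrightarrow> norm (z ^ m * h z) \<le> B"
    and z: "z \<in> \<bbbD>"
  shows "norm (h z) \<le> B"
proof -
  have "t ^ m * norm (h z) \<le> B" if t: "norm z < t" "t < 1" for t
  proof -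
    have t0: "0 < t" using t(1) norm_ge_zero[of z] by linarith
    have "norm (h z) \<le> B / t ^ m"
    proof (rule maximum_modulus_frontier[of h "cball 0 t"])
      have sub: "cball 0 t \<subseteq> \<bbbD>" using t by auto
      show "h holomorphic_on interior (cball 0 t)"
        using sub by (intro holomorphic_on_subset[OF hol]) auto
      show "continuous_on (closure (cball 0 t)) h"
        using sub by (auto intro: continuous_on_subset[OF holomorphic_on_imp_continuous_on[OF hol]])
      show "norm (h w) \<le> B / t ^ m" if "w \<in> frontier (cball 0 t)" for w
      proof -
        have w: "norm w = t" using that by auto
        then show ?thesis using le[of w] t t0
          by (simp add: norm_mult norm_power field_simps)
      qed
    qed (use t in auto)
    then show ?thesis using t0 by (simp add: field_simps)
  qed
  then have "\<forall>\<^sub>F t in at_left 1. t ^ m * norm (h z) \<le> B"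
    using z by (auto intro: eventually_at_leftI[of "norm z"])
  moreover have "((\<lambda>t::real. t ^ m * norm (h z)) \<longlongrightarrow> 1 ^ m * norm (h z)) (at_left 1)"
    by (intro tendsto_intros)
  ultimately have "1 ^ m * norm (h z) \<le> B"
    by (intro tendsto_upperbound) (auto simp: trivial_limit_at_left_real)
  then show ?thesis by simp
qed

text \<open>
  With \<open>g = 1 + z k\<close> a zero of \<open>g\<close> is a fixed point of \<open>z \<mapsto> - 1 / k z\<close>. Since \<open>k\<close> varies by at most \<open>1/2\<close>
  on the disk of radius \<open>1/2\<close>, a value \<open>\<bar>k 0\<bar> \<ge> 5/2\<close> would force \<open>\<bar>k\<bar> \<ge> 2\<close> there, so this map would
  send that disk into itself and Brouwer's theorem would produce a zero. Hence \<open>\<bar>k 0\<bar> < 5/2\<close>, so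
  \<open>\<bar>k\<bar> \<le> 4\<close> on the whole disk, and \<open>\<bar>g\<bar> \<le> 1 + 4\<close>.
\<close>
lemma denominators_bounded:
  assumes r: "r \<le> 1" and g: "g \<in> denominators r" and z: "z \<in> \<bbbD>"
  shows "norm (g z) \<le> 5"
proof -
  have holg: "g holomorphic_on \<bbbD>" and g0: "g 0 = 1"
    and nz: "\<And>z. z \<in> \<bbbD> \<Longrightarrow> g z \<noteq> 0"
    and bd: "\<And>z. z \<in> \<bbbD> \<Longrightarrow> norm (g z - z * deriv g z - 1) < r"
    using g by (auto simp: denominators_def)
  define k where "k = (\<lambda>z. if z = 0 then deriv g 0 else (g z - g 0) / (z - 0))"
  have holk: "k holomorphic_on \<bbbD>"
    unfolding k_def by (rule pole_lemma_open[OF holg open_ball])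
  have gk: "g z = 1 + z * k z" for z by (simp add: k_def g0)
  have dk: "(k has_field_derivative deriv k z) (at z)" if "z \<in> \<bbbD>" for z
    using holk that by (intro holomorphic_derivI) auto
  have dg: "deriv g z = k z + z * deriv k z" if "z \<in> \<bbbD>" for z
  proof (rule DERIV_imp_deriv)
    show "(g has_field_derivative k z + z * deriv k z) (at z)"
      unfolding gk[abs_def] by (auto intro!: derivative_eq_intros dk[OF that])
  qed
  have "g z - z * deriv g z - 1 = - (z ^ 2 * deriv k z)" if "z \<in> \<bbbD>" for z
    by (simp add: dg[OF that] gk[of z] algebra_simps power2_eq_square)
  then have "norm (z ^ 2 * deriv k z) \<le> 1" if "z \<in> \<bbbD>" for z
    using bd[OF that] r that by (metis less_eq_real_def norm_minus_cancel order_trans)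
  then have dk1: "norm (deriv k z) \<le> 1" if "z \<in> \<bbbD>" for z
    using holomorphic_deriv[OF holk] that by (intro norm_le_of_power_mult[of "deriv k" 2 1]) auto
  have k_near: "norm (k z - k 0) \<le> norm z" if "z \<in> \<bbbD>" for z
  proof -
    have "norm (k z - k 0) \<le> 1 * norm (z - 0)"
      by (rule field_differentiable_bound[OF convex_ball, of 0 1 k "deriv k"])
        (use dk dk1 that in \<open>auto intro: has_field_derivative_at_within\<close>)
    then show ?thesis by simp
  qed
  have k0: "norm (k 0) < 5 / 2"
  proof (rule ccontr)
    assume "\<not> ?thesis"
    then have large: "norm (k z) \<ge> 2" if "z \<in> cball 0 (1/2)" for z
      using k_near[of z] that norm_triangle_ineq2[of "k 0" "k z"] norm_minus_commute[of "k 0" "k z"]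
      by simp
    have sub: "cball 0 (1/2) \<subseteq> \<bbbD>" by (simp add: cball_subset_ball_iff)
    obtain w where w: "w \<in> cball 0 (1/2)" "- 1 / k w = w"
    proof (rule brouwer_ball[of "1/2" 0 "\<lambda>z. - 1 / k z"])
      have "continuous_on (cball 0 (1/2)) k"
        by (rule continuous_on_subset[OF holomorphic_on_imp_continuous_on[OF holk] sub])
      then show "continuous_on (cball 0 (1/2)) (\<lambda>z. - 1 / k z)"
        using large by (intro continuous_intros) fastforce+
      show "(\<lambda>z. - 1 / k z) \<in> cball 0 (1/2) \<rightarrow> cball 0 (1/2)"
      proof
        fix z :: complex assume "z \<in> cball 0 (1/2)"
        from large[OF this] show "- 1 / k z \<in> cball 0 (1/2)"
          by (simp add: norm_divide divide_simps)
      qed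
    qed auto
    have "k w \<noteq> 0" using large[OF w(1)] by auto
    then have "(- 1 / k w) * k w = - 1" by simp
    then have "w * k w = - 1" unfolding w(2) .
    then have "g w = 0" using gk[of w] by simp
    then show False using nz[of w] w(1) sub by blast
  qed
  have "norm (k z) \<le> 4"
    using k_near[OF z] k0 z norm_triangle_ineq2[of "k z" "k 0"] by simp
  then have "norm (z * k z) \<le> 1 * 4"
    unfolding norm_mult using z by (intro mult_mono) auto
  then show ?thesis
    using norm_triangle_ineq[of 1 "z * k z"] by (simp add: gk[of z])
qed


section \<open>Limits of denominators and compactness of the class\<close>

lemma norm_less_of_norm_le_of_zero:
  fixes p :: "complex \<Rightarrow> complex"
  assumes S: "open S" "connected S" and hol: "p holomorphic_on S"
    and le: "\<And>z. z \<in> S \<Longrightarrow> norm (p z) \<le> r" and r: "0 < r"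
    and a: "a \<in> S" "p a = 0" and z: "z \<in> S"
  shows "norm (p z) < r"
proof (rule ccontr)
  assume "\<not> ?thesis"
  then have eq: "norm (p z) = r" using le[OF z] by simp
  have "p constant_on S"
    using hol S S(1) subset_refl z by (rule maximum_modulus_principle) (use le eq in auto)
  then have "p z = p a" using a z by (auto simp: constant_on_def)
  then show False using a r eq by simp
qed

text \<open>
  The normalisation at \<open>0\<close> is used twice: \<open>G 0 = 1\<close> excludes the case \<open>G = 0\<close> left open by Hurwitz's
  theorem, and makes \<open>G - z G' - 1\<close> vanish at \<open>0\<close>, so that its modulus cannot reach the bound \<open>r\<close>.
\<close>
lemma denominators_limit:
  assumes r: "0 < r" and g: "\<And>n. g n \<in> denominators r"
    and holG: "G holomorphic_on \<bbbD>"
    and lim: "\<And>K. compact K \<Longrightarrow> K \<subseteq> \<bbbD> \<Longrightarrow> uniform_limit K g G sequentially"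
  shows "G \<in> denominators r"
proof -
  have holg: "\<And>n. g n holomorphic_on \<bbbD>" and g0: "\<And>n. g n 0 = 1"
    and nz: "\<And>n z. z \<in> \<bbbD> \<Longrightarrow> g n z \<noteq> 0"
    and bd: "\<And>n z. z \<in> \<bbbD> \<Longrightarrow> norm (g n z - z * deriv (g n) z - 1) < r"
    using g by (auto simp: denominators_def)
  have ptw: "(\<lambda>n. g n z) \<longlonglongrightarrow> G z" if "z \<in> \<bbbD>" for z
    using lim[of "{z}"] that by (simp add: tendsto_uniform_limitI)
  have dptw: "(\<lambda>n. deriv (g n) z) \<longlonglongrightarrow> deriv G z" if z: "z \<in> \<bbbD>" for z
  proof -
    \<comment> \<open>Convergence is uniform only on compact subsets, so derivatives are compared on a smaller disk.\<close>
    obtain t where t: "norm z < t" "t < 1" using z dense[of "norm z" 1] by auto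
    have "uniform_limit (ball 0 t) g G sequentially"
      by (rule uniform_limit_on_subset[OF lim[of "cball 0 t"]]) (use t in auto)
    moreover have "\<forall>\<^sub>F n in sequentially. g n holomorphic_on ball 0 t"
      using t by (intro always_eventually allI holomorphic_on_subset[OF holg]) auto
    ultimately have "(\<lambda>n. (deriv ^^ 1) (g n) z) \<longlonglongrightarrow> (deriv ^^ 1) G z"
      by (rule higher_deriv_complex_uniform_limit) (use t in auto)
    then show ?thesis by simp
  qed
  have G0: "G 0 = 1" using ptw[of 0] by (simp add: g0 LIMSEQ_const_iff)
  have Gnz: "G z \<noteq> 0" if z: "z \<in> \<bbbD>" for z
  proof (cases "G constant_on \<bbbD>")
    case True
    then show ?thesis using G0 z by (auto simp: constant_on_def)
  next
    case False
    show ?thesis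
      by (rule Hurwitz_no_zeros[OF open_ball connected_ball holg holG lim False nz z])
  qed
  let ?p = "\<lambda>z. G z - z * deriv G z - 1"
  have ple: "norm (?p z) \<le> r" if z: "z \<in> \<bbbD>" for z
  proof (rule tendsto_upperbound)
    show "(\<lambda>n. norm (g n z - z * deriv (g n) z - 1)) \<longlonglongrightarrow> norm (?p z)"
      by (intro tendsto_intros ptw dptw z)
    show "\<forall>\<^sub>F n in sequentially. norm (g n z - z * deriv (g n) z - 1) \<le> r"
      using bd[OF z] by (intro always_eventually allI less_imp_le)
  qed simp
  have "norm (?p z) < r" if "z \<in> \<bbbD>" for z
  proof (rule norm_less_of_norm_le_of_zero[OF open_ball connected_ball _ ple r _ _ that])
    show "?p holomorphic_on \<bbbD>"
      by (intro holomorphic_intros holG holomorphic_deriv) auto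
    show "0 \<in> \<bbbD>" "?p 0 = 0" using G0 by simp_all
  qed
  then show ?thesis using holG G0 Gnz by (auto simp: denominators_def)
qed

theorem theorem2p1:
  fixes r :: real
  assumes "0 < r" and "r \<le> 1"
  shows "compactin H_topology (\<U> r)"
proof (rule compactin_H_topology_if_convergent_subseq)
  show "\<U> r \<subseteq> \<H>" by (auto simp: class_U_def class_A_def)
next
  fix \<sigma> :: "nat \<Rightarrow> complex \<Rightarrow> complex" assume "range \<sigma> \<subseteq> \<U> r"
  then have \<sigma>: "\<sigma> n \<in> \<U> r" for n by blast
  have den: "z_over (\<sigma> n) \<in> denominators r" for n by (rule z_over_in_denominators(1)[OF \<sigma>])
  obtain G s where holG: "G holomorphic_on \<bbbD>" and s: "strict_mono s"
    and lim: "\<And>K. compact K \<Longrightarrow> K \<subseteq> \<bbbD> \<Longrightarrow>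
      uniform_limit K ((\<lambda>n. z_over (\<sigma> n)) \<circ> s) G sequentially"
  proof (rule Montel[of \<bbbD> "denominators r" "\<lambda>n. z_over (\<sigma> n)"])
    fix K :: "complex set" assume "K \<subseteq> \<bbbD>"
    then show "\<exists>B. \<forall>h\<in>denominators r. \<forall>z\<in>K. norm (h z) \<le> B"
      using denominators_bounded[OF assms(2)] by blast
  qed (use den in \<open>auto simp: denominators_def\<close>)
  have G: "G \<in> denominators r"
    using denominators_limit[OF assms(1) _ holG lim] den by simp
  have "uniform_limit K (\<sigma> \<circ> s) (restrict (\<lambda>z. z / G z) \<bbbD>) sequentially"
    if K: "compact K" "K \<subseteq> \<bbbD>" for K
  proof -
    \<comment> \<open>On \<open>K\<close> the limit \<open>G\<close> is bounded away from \<open>0\<close>, so uniform convergence passes to quotients.\<close>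
    have contG: "continuous_on K G"
      by (rule continuous_on_subset[OF holomorphic_on_imp_continuous_on[OF holG] K(2)])
    have Gnz: "G z \<noteq> 0" if "z \<in> K" for z using that G K(2) by (auto simp: denominators_def)
    have "compact (G ` K)" using contG K(1) by (rule compact_continuous_image)
    moreover have "0 \<notin> G ` K" using Gnz by auto
    ultimately obtain b where b: "b > 0" "\<And>z. z \<in> K \<Longrightarrow> b \<le> norm (G z)"
      using separate_point_closed[of "G ` K" 0] by (auto simp: compact_imp_closed)
    have "uniform_limit K (\<lambda>n z. z / z_over (\<sigma> (s n)) z) (\<lambda>z. z / G z) sequentially"
    proof (rule uniform_lim_divide[OF uniform_limit_const _ _ b(2,1)])
      show "uniform_limit K (\<lambda>n. z_over (\<sigma> (s n))) G sequentially"
        using lim[OF K] by (simp add: o_def)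
      show "bounded ((\<lambda>z. z) ` K)" using K(1) by (simp add: compact_imp_bounded)
    qed
    moreover have "z / z_over (\<sigma> n) z = \<sigma> n z" if "z \<in> K" for n z
      using fun_cong[OF z_over_in_denominators(2)[OF \<sigma>], of n z] K(2) that by auto
    ultimately show ?thesis
      using K(2) by (subst uniform_limit_cong') (auto simp: subset_iff)
  qed
  then show "\<exists>f\<in>\<U> r. \<exists>s. strict_mono s \<and>
      (\<forall>K. compact K \<longrightarrow> K \<subseteq> \<bbbD> \<longrightarrow> uniform_limit K (\<sigma> \<circ> s) f sequentially)"
    using restrict_quotient_in_class_U[OF G] s by blast
qed

end
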